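(* Let $p$ be a probability density on $\mathbb{R}^d$, let $v\in\mathbb{R}^d$ and $s\ge 0$, and let $$p^*(x)=\frac{p(x)\,e^{v^T x-\frac12 s\|x\|^2}}{E_p[e^{v^T x-\frac12 s\|x\|^2}]},$$ where the normalizing constant is finite. For $\sigma\in[0,1]$, let $q(\cdot,\sigma)$ and $q^*(\cdot,\sigma)$ denote the densities of $\sqrt{1-\sigma^2}\,X+\sigma Z$ and $\sqrt{1-\sigma^2}\,X'+\sigma Z$ respectively, where $X\sim p$, $X'\sim p^*$, and $Z\sim N(0,I)$ is independent of $X$ and of $X'$. Define $$u'=\frac{\sigma^2}{\sqrt{(1-\sigma^2+s\sigma^2)(1+s\sigma^2)}}\,v+\sqrt{\frac{1-\sigma^2}{(1-\sigma^2+s\sigma^2)(1+s\sigma^2)}}\;u,\qquad \sigma'=\sqrt{\frac{\sigma^2}{1+s\sigma^2}}.$$ Then the score of the tilt under convolution is related to the score of the original density under convolution by $$\nabla\log q^*(u,\sigma)=-\frac{1}{\sigma^2}\left(u-\sqrt{\frac{1-\sigma^2}{1-(\sigma')^2}}\;u'\right)+\frac{(\sigma')^2\sqrt{1-\sigma^2}}{\sigma^2\sqrt{1-(\sigma')^2}}\;\nabla\log q(u',\sigma').$$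
   Context: All densities are with respect to Lebesgue measure on $\mathbb{R}^d$; the reference density has the form $p(x)\propto e^{-V(x)}$. $E_p[h(x)]=\int h(x)p(x)\,dx$. The gradient $\nabla$ is with respect to the spatial (first) argument: $\nabla\log q(u',\sigma')$ means the gradient of $w\mapsto\log q(w,\sigma')$ evaluated at $w=u'$ (not the gradient of a composition with $u\mapsto u'$). The author remarks that, although certain quantities in the formula seem to divide by zero when $\sigma=0$ or $\sigma=1$, by rearranging the expression it is a well-defined equation for all $\sigma$, even at $0$ and $1$. *)

theory Defs
  imports "HOL-Probability.Probability"
begin

definition gradient :: "('a::euclidean_space \<Rightarrow> real) \<Rightarrow> 'a \<Rightarrow> 'a" where
  "gradient f x = (THE D. GDERIV f x :> D)"

definition prob_density :: "('a::euclidean_space \<Rightarrow> real) \<Rightarrow> bool" where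
  "prob_density p \<longleftrightarrow>
     (\<forall>x. 0 \<le> p x) \<and> integrable lborel p \<and> (\<integral>x. p x \<partial>lborel) = 1"

definition expect :: "('a::euclidean_space \<Rightarrow> real) \<Rightarrow> ('a \<Rightarrow> real) \<Rightarrow> real" where
  "expect p h = (\<integral>x. h x * p x \<partial>lborel)"

definition tilt_factor :: "'a::euclidean_space \<Rightarrow> real \<Rightarrow> 'a \<Rightarrow> real" where
  "tilt_factor v s x = exp (v \<bullet> x - 1 / 2 * s * (norm x)\<^sup>2)"

definition tilt ::
  "('a::euclidean_space \<Rightarrow> real) \<Rightarrow> 'a \<Rightarrow> real \<Rightarrow> 'a \<Rightarrow> real" where
  "tilt p v s x = p x * tilt_factor v s x / expect p (tilt_factor v s)"

definition std_gaussian_density :: "'a::euclidean_space \<Rightarrow> real" where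
  "std_gaussian_density z =
     (2 * pi) powr (- real DIM('a) / 2) * exp (- (norm z)\<^sup>2 / 2)"

text \<open>
  A density is determined only up to null sets, whereas the score is a pointwise
  notion, so a version has to be fixed: for positive noise level the continuous
  (hence unique) density, and at noise level 0, where the variable is X itself,
  the given density p of X.
\<close>

definition convolved_densities ::
  "'w measure \<Rightarrow> ('w \<Rightarrow> 'a::euclidean_space) \<Rightarrow> ('w \<Rightarrow> 'a) \<Rightarrow> ('a \<Rightarrow> real)
     \<Rightarrow> ('a \<Rightarrow> real \<Rightarrow> real) \<Rightarrow> bool" where
  "convolved_densities M X Z p q \<longleftrightarrow>
     (\<forall>\<sigma>\<in>{0..1}.
        (\<forall>u. 0 \<le> q u \<sigma>) \<and>
        distributed M lborel (\<lambda>\<omega>. sqrt (1 - \<sigma>\<^sup>2) *\<^sub>R X \<omega> + \<sigma> *\<^sub>R Z \<omega>)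
          (\<lambda>u. ennreal (q u \<sigma>)) \<and>
        (0 < \<sigma> \<longrightarrow> continuous_on UNIV (\<lambda>u. q u \<sigma>))) \<and>
     (\<forall>u. q u 0 = p u)"

text \<open>
  Dividing by zero: for positive noise level below 1, no denominator in the score
  identity vanishes. At \<open>\<sigma> = 0\<close> the factors \<open>1 / \<sigma>\<^sup>2\<close> are removable; substituting
  \<open>\<sigma>'\<^sup>2 = \<sigma>\<^sup>2 / (1 + s * \<sigma>\<^sup>2)\<close> and cancelling gives the coefficients
  \<open>1 / (1 - \<sigma>\<^sup>2 + s * \<sigma>\<^sup>2)\<close> of \<open>sqrt (1 - \<sigma>\<^sup>2) *\<^sub>R v - s *\<^sub>R u\<close> and
  \<open>sqrt ((1 - \<sigma>\<^sup>2) / ((1 - \<sigma>\<^sup>2 + s * \<sigma>\<^sup>2) * (1 + s * \<sigma>\<^sup>2)))\<close> of the original score.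
  This second form is well defined for every noise level in [0, 1], except for
  \<open>\<sigma> = 1\<close> together with \<open>s = 0\<close>. In that corner the point \<open>u'\<close> itself has a pole
  (for nonzero v), and only the unsimplified form holds, by the convention
  \<open>x / 0 = 0\<close>: both sides are then the Gaussian score \<open>- u\<close>.
\<close>

end

theory Submission imports Defs begin

text \<open>
  For positive noise level \<open>\<sigma>\<close> the density of the noised variable is the Gaussian smoothing
  \<open>\<integral> p x * exp (- |w - a x|\<^sup>2 / (2 \<sigma>\<^sup>2)) dx\<close> with \<open>a = sqrt (1 - \<sigma>\<^sup>2)\<close>, up to a constant.
  Multiplying \<open>p\<close> by the exponential of a quadratic and completing the square in \<open>x\<close> turns the
  kernel at \<open>(w, \<sigma>)\<close> into the kernel at \<open>(w', \<sigma>')\<close>, at the cost of a factor that does not depend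
  on \<open>x\<close>.  So the smoothed tilt at \<open>w\<close> is an explicit Gaussian factor times the smoothed original at
  the point \<open>w'\<close>, which is affine in \<open>w\<close>; the chain rule gives the score identity.
\<close>

section \<open>Gradients and differentiation under the integral sign\<close>

lemma gradient_eqI:
  assumes "GDERIV f x :> D"
  shows "gradient f x = D"
  unfolding gradient_def
proof (rule the_equality)
  fix D' assume "GDERIV f x :> D'"
  then have "(\<lambda>h. h \<bullet> D') = (\<lambda>h. h \<bullet> D)"
    using assms unfolding gderiv_def by (rule has_derivative_unique)
  then have "h \<bullet> (D' - D) = 0" for h
    by (metis inner_diff_right right_minus_eq)
  then show "D' = D"
    by (metis inner_eq_zero_iff right_minus_eq)
qed (fact assms)

text \<open>A linear functional is the inner product with the vector whose coordinates are its
  values on \<open>Basis\<close>. So the derivative has a representing vector, and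
  \<open>gradient_eqI\<close> identifies it with the definite description.\<close>

lemma GDERIV_gradient:
  assumes "f differentiable (at x)"
  shows "GDERIV f x :> gradient f x"
proof -
  obtain f' where f': "(f has_derivative f') (at x)"
    using assms by (auto simp: differentiable_def)
  interpret bounded_linear f'
    using f' by (rule has_derivative_bounded_linear)
  have "f' h = h \<bullet> (\<Sum>b\<in>Basis. f' b *\<^sub>R b)" for h
  proof -
    have "f' h = f' (\<Sum>b\<in>Basis. (h \<bullet> b) *\<^sub>R b)"
      by (simp add: euclidean_representation)
    also have "\<dots> = h \<bullet> (\<Sum>b\<in>Basis. f' b *\<^sub>R b)"
      by (simp add: sum scaleR inner_sum_right mult.commute)
    finally show ?thesis .
  qed
  then have "f' = (\<lambda>h. h \<bullet> (\<Sum>b\<in>Basis. f' b *\<^sub>R b))"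
    by blast
  then have "GDERIV f x :> (\<Sum>b\<in>Basis. f' b *\<^sub>R b)"
    using f' by (simp add: gderiv_def)
  then show ?thesis
    using gradient_eqI by metis
qed

lemma GDERIV_imp_differentiable: "GDERIV f x :> D \<Longrightarrow> f differentiable (at x)"
  by (auto simp: gderiv_def differentiable_def)

lemma GDERIV_imp_isCont: "GDERIV f x :> D \<Longrightarrow> isCont f x"
  unfolding gderiv_def by (rule has_derivative_continuous)

lemma GDERIV_affine_compose:
  assumes "GDERIV f (c + k *\<^sub>R x) :> D"
  shows "GDERIV (\<lambda>w. f (c + k *\<^sub>R w)) x :> k *\<^sub>R D"
proof -
  have "((\<lambda>w. c + k *\<^sub>R w) has_derivative (\<lambda>h. k *\<^sub>R h)) (at x)"
    by (auto intro!: derivative_eq_intros)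
  from has_derivative_compose[OF this assms[unfolded gderiv_def]]
  show ?thesis by (simp add: gderiv_def)
qed

lemma GDERIV_norm_squared: "GDERIV (\<lambda>w. (norm w)\<^sup>2) x :> 2 *\<^sub>R x"
  unfolding gderiv_def power2_norm_eq_inner
  by (auto intro!: derivative_eq_intros simp: inner_commute)

lemma GDERIV_ln:
  assumes "GDERIV f x :> D" "0 < f x"
  shows "GDERIV (\<lambda>w. ln (f w)) x :> (1 / f x) *\<^sub>R D"
  using GDERIV_DERIV_compose[OF assms(1) DERIV_ln_divide[OF assms(2)]] .

text \<open>The remainder quotient \<open>R\<close> of the integrand tends to 0 pointwise and is
  dominated by \<open>2 * B\<close>: \<open>lip\<close> controls the increment and
  \<open>g_le\<close> the linear term. Dominated convergence carries the limit through the
  integral.\<close>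

lemma GDERIV_integral_dominated:
  fixes f :: "'a::euclidean_space \<Rightarrow> 'b \<Rightarrow> real" and g :: "'b \<Rightarrow> 'a"
  assumes f: "\<And>w. integrable N (f w)"
    and B: "integrable N B"
    and [measurable]: "g \<in> borel_measurable N"
    and deriv: "\<And>x. GDERIV (\<lambda>w. f w x) w\<^sub>0 :> g x"
    and lip: "\<And>w x. \<bar>f w x - f w\<^sub>0 x\<bar> \<le> B x * norm (w - w\<^sub>0)"
    and g_le: "\<And>x. norm (g x) \<le> B x"
  shows "GDERIV (\<lambda>w. \<integral>x. f w x \<partial>N) w\<^sub>0 :> (\<integral>x. g x \<partial>N)"
proof -
  have B0: "0 \<le> B x" for x
    using g_le[of x] norm_ge_zero[of "g x"] by linarith
  have g: "integrable N g"
    using B by (rule Bochner_Integration.integrable_bound) (use g_le B0 in auto)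
  note [measurable] = borel_measurable_integrable[OF f]
  define R where "R w x = (f w x - f w\<^sub>0 x - (w - w\<^sub>0) \<bullet> g x) /\<^sub>R norm (w - w\<^sub>0)" for w x
  have int_R: "(\<integral>x. R w x \<partial>N) = ((\<integral>x. f w x \<partial>N) - (\<integral>x. f w\<^sub>0 x \<partial>N) - (w - w\<^sub>0) \<bullet> (\<integral>x. g x \<partial>N))
      /\<^sub>R norm (w - w\<^sub>0)" for w
    using f g by (simp add: R_def)
  have [measurable]: "R w \<in> borel_measurable N" for w
    unfolding R_def by measurable
  have R_le: "norm (R w x) \<le> 2 * B x" for w x
  proof -
    have "\<bar>(w - w\<^sub>0) \<bullet> g x\<bar> \<le> B x * norm (w - w\<^sub>0)"
      using Cauchy_Schwarz_ineq2[of "w - w\<^sub>0" "g x"] mult_left_mono[OF g_le[of x] norm_ge_zero[of "w - w\<^sub>0"]]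
      by (simp add: mult.commute)
    then have "\<bar>f w x - f w\<^sub>0 x - (w - w\<^sub>0) \<bullet> g x\<bar> \<le> 2 * B x * norm (w - w\<^sub>0)"
      using lip[of w x] by linarith
    \<comment> \<open>At \<open>w = w\<^sub>0\<close> the inverse of the zero norm is 0, so
      \<open>R\<close> vanishes there and the bound reduces to \<open>0 \<le> B x\<close>.\<close>
    then show ?thesis
      using B0[of x] by (cases "w = w\<^sub>0") (auto simp: R_def abs_mult field_simps)
  qed
  \<comment> \<open>Dominated convergence speaks of sequences, so the limit is tested along
    sequences that avoid \<open>w\<^sub>0\<close>.\<close>
  have "((\<lambda>w. \<integral>x. R w x \<partial>N) \<longlongrightarrow> 0) (at w\<^sub>0)"
    unfolding tendsto_at_iff_sequentially comp_def
  proof (intro allI impI)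
    fix W :: "nat \<Rightarrow> 'a"
    assume W: "\<forall>i. W i \<in> UNIV - {w\<^sub>0}" "W \<longlonglongrightarrow> w\<^sub>0"
    have "(\<lambda>i. \<integral>x. R (W i) x \<partial>N) \<longlonglongrightarrow> (\<integral>x. 0 \<partial>N)"
    proof (rule integral_dominated_convergence)
      show "integrable N (\<lambda>x. 2 * B x)"
        using B by simp
      show "AE x in N. (\<lambda>i. R (W i) x) \<longlonglongrightarrow> 0"
      proof (intro AE_I2)
        fix x
        have "((\<lambda>w. R w x) \<longlongrightarrow> 0) (at w\<^sub>0)"
          using deriv[of x] by (simp add: R_def gderiv_def has_derivative_at_within)
        then show "(\<lambda>i. R (W i) x) \<longlonglongrightarrow> 0"
          using W unfolding tendsto_at_iff_sequentially comp_def by blast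
      qed
      show "AE x in N. norm (R (W i) x) \<le> 2 * B x" for i
        using R_le by simp
    qed simp_all
    then show "(\<lambda>i. \<integral>x. R (W i) x \<partial>N) \<longlonglongrightarrow> 0"
      by simp
  qed
  then show ?thesis
    by (simp add: gderiv_def has_derivative_at_within int_R bounded_linear_inner_left)
qed

section \<open>The unnormalised Gaussian kernel and its uniform bounds\<close>

definition gauss_kernel :: "real \<Rightarrow> 'a::euclidean_space \<Rightarrow> real" where
  "gauss_kernel \<sigma> y = exp (- (norm y)\<^sup>2 / (2 * \<sigma>\<^sup>2))"

lemma gauss_kernel_pos: "0 < gauss_kernel \<sigma> y"
  by (simp add: gauss_kernel_def)

lemma gauss_kernel_le_1: "gauss_kernel \<sigma> y \<le> 1"
  by (simp add: gauss_kernel_def)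

lemma borel_measurable_gauss_kernel [measurable]: "gauss_kernel \<sigma> \<in> borel_measurable borel"
  unfolding gauss_kernel_def by measurable

lemma GDERIV_gauss_kernel:
  "GDERIV (gauss_kernel \<sigma>) y :> - (gauss_kernel \<sigma> y / \<sigma>\<^sup>2) *\<^sub>R y"
proof -
  \<comment> \<open>For \<open>\<sigma> = 0\<close>, division by zero makes the kernel constantly 1
    and the claimed derivative 0, so the formula survives.\<close>
  have "DERIV (\<lambda>t. exp (- t / (2 * \<sigma>\<^sup>2))) ((norm y)\<^sup>2) :> - gauss_kernel \<sigma> y / (2 * \<sigma>\<^sup>2)"
    by (cases "\<sigma> = 0") (auto intro!: derivative_eq_intros simp: gauss_kernel_def field_simps)
  from GDERIV_DERIV_compose[OF GDERIV_norm_squared this]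
  show ?thesis by (simp add: gauss_kernel_def[abs_def])
qed

text \<open>With \<open>t = norm y\<close>, the left-hand side is \<open>1 / \<sigma>\<close> times
  the product of the kernel and \<open>t / \<sigma>\<close>. That product is at most 1, because
  \<open>t / \<sigma>\<close> is bounded by the reciprocal of the kernel.\<close>

lemma norm_gauss_kernel_gradient_le:
  assumes "0 < \<sigma>"
  shows "norm ((gauss_kernel \<sigma> y / \<sigma>\<^sup>2) *\<^sub>R y) \<le> 1 / \<sigma>"
proof -
  define t where "t = norm y"
  \<comment> \<open>Expanding yields \<open>t / \<sigma> \<le> 1 / 2 + t\<^sup>2 / (2 *
    \<sigma>\<^sup>2)\<close>; the constant is relaxed to 1 to meet
    \<open>1 + x \<le> exp x\<close>.\<close>
  have "0 \<le> (t / \<sigma> - 1)\<^sup>2"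
    by simp
  then have "t / \<sigma> \<le> 1 + t\<^sup>2 / (2 * \<sigma>\<^sup>2)"
    by (simp add: power2_diff power_divide)
  also have "\<dots> \<le> exp (t\<^sup>2 / (2 * \<sigma>\<^sup>2))"
    by (rule exp_ge_add_one_self)
  finally have "gauss_kernel \<sigma> y * (t / \<sigma>) \<le> gauss_kernel \<sigma> y * exp (t\<^sup>2 / (2 * \<sigma>\<^sup>2))"
    by (intro mult_left_mono less_imp_le[OF gauss_kernel_pos])
  also have "\<dots> = 1"
    by (simp add: gauss_kernel_def t_def flip: exp_add)
  finally show ?thesis
    using assms by (simp add: t_def less_imp_le[OF gauss_kernel_pos] power2_eq_square field_simps)
qed

text \<open>Mean value inequality on the whole space with the uniform gradient bound. It supplies
  the hypothesis \<open>lip\<close> when the smoothed density is differentiated.\<close>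

lemma gauss_kernel_lipschitz:
  assumes "0 < \<sigma>"
  shows "\<bar>gauss_kernel \<sigma> y - gauss_kernel \<sigma> y'\<bar> \<le> 1 / \<sigma> * norm (y - y')"
proof -
  have "norm (gauss_kernel \<sigma> y - gauss_kernel \<sigma> y') \<le> 1 / \<sigma> * norm (y - y')"
  proof (rule differentiable_bound[OF convex_UNIV])
    fix x :: 'a
    show "(gauss_kernel \<sigma> has_derivative (\<lambda>h. h \<bullet> (- (gauss_kernel \<sigma> x / \<sigma>\<^sup>2) *\<^sub>R x))) (at x)"
      using GDERIV_gauss_kernel unfolding gderiv_def .
    show "onorm (\<lambda>h. h \<bullet> (- (gauss_kernel \<sigma> x / \<sigma>\<^sup>2) *\<^sub>R x)) \<le> 1 / \<sigma>"
    proof (rule onorm_bound)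
      fix h
      show "norm (h \<bullet> (- (gauss_kernel \<sigma> x / \<sigma>\<^sup>2) *\<^sub>R x)) \<le> 1 / \<sigma> * norm h"
        using Cauchy_Schwarz_ineq2[of h "- (gauss_kernel \<sigma> x / \<sigma>\<^sup>2) *\<^sub>R x"]
          mult_left_mono[OF norm_gauss_kernel_gradient_le[OF assms, of x] norm_ge_zero[of h]]
        by (simp add: mult.commute)
    qed (use assms in simp)
  qed auto
  then show ?thesis by simp
qed

section \<open>The smoothed density: positivity and differentiability\<close>

lemma prob_density_weighted_integral_pos:
  assumes p: "prob_density p" and h: "\<And>x. 0 < h x" and int: "integrable lborel (\<lambda>x. p x * h x)"
  shows "0 < (\<integral>x. p x * h x \<partial>lborel)"
proof (rule ccontr)
  have p0: "0 \<le> p x" for x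
    using p by (simp add: prob_density_def)
  have nn: "0 \<le> p x * h x" for x
    using p0[of x] h[of x] by simp
  \<comment> \<open>Otherwise the nonnegative integrand vanishes almost everywhere; as
    \<open>h\<close> is positive, so does \<open>p\<close>, against total mass 1.\<close>
  assume "\<not> ?thesis"
  then have "(\<integral>x. p x * h x \<partial>lborel) = 0"
    using integral_nonneg_AE[of "\<lambda>x. p x * h x" lborel] nn by (simp add: antisym)
  then have "AE x in lborel. p x * h x = 0"
    using integral_nonneg_eq_0_iff_AE[OF int] nn by simp
  then have "AE x in lborel. p x = 0"
    by eventually_elim (metis h less_irrefl mult_eq_0_iff)
  then have "(\<integral>x. p x \<partial>lborel) = 0"
    by (rule integral_eq_zero_AE)
  then show False
    using p by (simp add: prob_density_def)
qed

text \<open>A mixture over \<open>x\<close> of Gaussians centred at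
  \<open>sqrt (1 - \<sigma>\<^sup>2) *\<^sub>R x\<close>, rather than a convolution of two
  densities: at \<open>\<sigma> = 1\<close> the scaled variable is constant and has no density,
  while the mixture still makes sense.\<close>

definition noised_density :: "('a::euclidean_space \<Rightarrow> real) \<Rightarrow> real \<Rightarrow> 'a \<Rightarrow> real" where
  "noised_density p \<sigma> w = (2 * pi) powr (- real DIM('a) / 2) / \<sigma> ^ DIM('a) *
     (\<integral>x. p x * gauss_kernel \<sigma> (w - sqrt (1 - \<sigma>\<^sup>2) *\<^sub>R x) \<partial>lborel)"

context
  fixes p :: "'a::euclidean_space \<Rightarrow> real"
  assumes p: "prob_density p"
begin

lemma prob_density_nonneg: "0 \<le> p x" and prob_density_integrable: "integrable lborel p"
  using p by (auto simp: prob_density_def)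

lemma prob_density_measurable [measurable]: "p \<in> borel_measurable borel"
  using borel_measurable_integrable[OF prob_density_integrable] by simp

lemma integrable_prob_density_gauss_kernel:
  "integrable lborel (\<lambda>x. p x * gauss_kernel \<sigma> (w - a *\<^sub>R x))"
  using prob_density_integrable
  by (rule Bochner_Integration.integrable_bound)
    (auto simp: abs_mult gauss_kernel_pos less_imp_le gauss_kernel_le_1 intro!: mult_left_le)

lemma noised_density_pos:
  assumes "0 < \<sigma>"
  shows "0 < noised_density p \<sigma> w"
  using assms prob_density_weighted_integral_pos[OF p gauss_kernel_pos integrable_prob_density_gauss_kernel]
  by (simp add: noised_density_def)

text \<open>The kernel has gradient and Lipschitz bound \<open>1 / \<sigma>\<close> at every point,
  so \<open>p x * (1 / \<sigma>)\<close> dominates, and it is integrable because \<open>p\<close>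
  is.\<close>

lemma noised_density_has_gradient:
  assumes "0 < \<sigma>"
  obtains D where "GDERIV (noised_density p \<sigma>) w :> D"
proof -
  define a where "a = sqrt (1 - \<sigma>\<^sup>2)"
  define g where "g x = p x *\<^sub>R (- (gauss_kernel \<sigma> (w - a *\<^sub>R x) / \<sigma>\<^sup>2) *\<^sub>R (w - a *\<^sub>R x))" for x
  have "GDERIV (\<lambda>w. \<integral>x. p x * gauss_kernel \<sigma> (w - a *\<^sub>R x) \<partial>lborel) w :> (\<integral>x. g x \<partial>lborel)"
  proof (rule GDERIV_integral_dominated)
    show "integrable lborel (\<lambda>x. p x * gauss_kernel \<sigma> (y - a *\<^sub>R x))" for y
      by (rule integrable_prob_density_gauss_kernel)
    show "integrable lborel (\<lambda>x. p x * (1 / \<sigma>))"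
      using prob_density_integrable by simp
    show "g \<in> borel_measurable lborel"
      unfolding g_def by measurable
    fix x
    have "GDERIV (\<lambda>w. gauss_kernel \<sigma> ((- (a *\<^sub>R x)) + 1 *\<^sub>R w)) w
        :> 1 *\<^sub>R (- (gauss_kernel \<sigma> (w - a *\<^sub>R x) / \<sigma>\<^sup>2) *\<^sub>R (w - a *\<^sub>R x))"
      by (rule GDERIV_affine_compose) (use GDERIV_gauss_kernel[of \<sigma> "w - a *\<^sub>R x"] in simp)
    from GDERIV_mult[OF GDERIV_const[of "p x"] this]
    show "GDERIV (\<lambda>w. p x * gauss_kernel \<sigma> (w - a *\<^sub>R x)) w :> g x"
      by (simp add: g_def)
    show "norm (g x) \<le> p x * (1 / \<sigma>)"
      using mult_left_mono[OF norm_gauss_kernel_gradient_le[OF assms, of "w - a *\<^sub>R x"] prob_density_nonneg[of x]]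
      by (simp add: g_def abs_mult prob_density_nonneg)
    fix y
    show "\<bar>p x * gauss_kernel \<sigma> (y - a *\<^sub>R x) - p x * gauss_kernel \<sigma> (w - a *\<^sub>R x)\<bar>
        \<le> p x * (1 / \<sigma>) * norm (y - w)"
      using mult_left_mono[OF gauss_kernel_lipschitz[OF assms, of "y - a *\<^sub>R x" "w - a *\<^sub>R x"] prob_density_nonneg[of x]]
      by (simp add: prob_density_nonneg abs_mult mult.assoc flip: right_diff_distrib)
  qed
  from GDERIV_mult[OF GDERIV_const[of "(2 * pi) powr (- real DIM('a) / 2) / \<sigma> ^ DIM('a)"] this]
  show thesis
    by (intro that) (simp add: noised_density_def[abs_def] a_def)
qed

lemma continuous_on_noised_density:
  assumes "0 < \<sigma>"
  shows "continuous_on UNIV (noised_density p \<sigma>)"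
  using noised_density_has_gradient[OF assms] GDERIV_imp_isCont
  by (metis continuous_at_imp_continuous_on)

end

section \<open>The law of the noised variable and its continuous density\<close>

lemma nn_integral_affine_euclidean:
  fixes f :: "'a::euclidean_space \<Rightarrow> ennreal"
  assumes [measurable]: "f \<in> borel_measurable borel" and c: "c \<noteq> 0"
  shows "(\<integral>\<^sup>+x. f x \<partial>lborel) = ennreal (\<bar>c\<bar> ^ DIM('a)) * (\<integral>\<^sup>+x. f (t + c *\<^sub>R x) \<partial>lborel)"
  by (subst lborel_affine[OF c, of t])
     (simp add: nn_integral_density nn_integral_distr nn_integral_cmult)

text \<open>Passes to nonnegative integrals, where Tonelli applies, and writes the kernel as the
  standard Gaussian at a rescaled argument, which is the shape produced by substituting in the law
  of \<open>Z\<close>.\<close>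

lemma noised_density_nn_integral:
  fixes p :: "'a::euclidean_space \<Rightarrow> real"
  assumes p: "prob_density p" and \<sigma>: "0 < \<sigma>"
  shows "ennreal (noised_density p \<sigma> u) =
    (\<integral>\<^sup>+x. ennreal (p x) * ennreal (std_gaussian_density ((u - sqrt (1 - \<sigma>\<^sup>2) *\<^sub>R x) /\<^sub>R \<sigma>)
       / \<sigma> ^ DIM('a)) \<partial>lborel)"
proof -
  let ?c = "(2 * pi) powr (- real DIM('a) / 2) / \<sigma> ^ DIM('a)"
  have "ennreal (noised_density p \<sigma> u)
      = ennreal (\<integral>x. ?c * (p x * gauss_kernel \<sigma> (u - sqrt (1 - \<sigma>\<^sup>2) *\<^sub>R x)) \<partial>lborel)"
    by (simp add: noised_density_def)
  also have "\<dots> = (\<integral>\<^sup>+x. ennreal (?c * (p x * gauss_kernel \<sigma> (u - sqrt (1 - \<sigma>\<^sup>2) *\<^sub>R x))) \<partial>lborel)"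
  proof (rule nn_integral_eq_integral[symmetric])
    show "integrable lborel (\<lambda>x. ?c * (p x * gauss_kernel \<sigma> (u - sqrt (1 - \<sigma>\<^sup>2) *\<^sub>R x)))"
      by (intro integrable_mult_right integrable_prob_density_gauss_kernel p)
    show "AE x in lborel. 0 \<le> ?c * (p x * gauss_kernel \<sigma> (u - sqrt (1 - \<sigma>\<^sup>2) *\<^sub>R x))"
      using \<sigma> by (intro AE_I2 mult_nonneg_nonneg prob_density_nonneg[OF p] less_imp_le[OF gauss_kernel_pos]) simp
  qed
  also have "\<dots> = (\<integral>\<^sup>+x. ennreal (p x) * ennreal (std_gaussian_density ((u - sqrt (1 - \<sigma>\<^sup>2) *\<^sub>R x) /\<^sub>R \<sigma>)
       / \<sigma> ^ DIM('a)) \<partial>lborel)"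
  proof (rule nn_integral_cong)
    fix x
    let ?y = "u - sqrt (1 - \<sigma>\<^sup>2) *\<^sub>R x"
    have "(norm (?y /\<^sub>R \<sigma>))\<^sup>2 / 2 = (norm ?y)\<^sup>2 / (2 * \<sigma>\<^sup>2)"
    proof -
      have "norm (?y /\<^sub>R \<sigma>) = norm ?y / \<sigma>"
        using \<sigma> by (simp add: divide_inverse mult.commute)
      then show ?thesis
        by (simp add: power_divide mult.commute)
    qed
    then have "?c * (p x * gauss_kernel \<sigma> ?y) = p x * (std_gaussian_density (?y /\<^sub>R \<sigma>) / \<sigma> ^ DIM('a))"
      by (simp add: std_gaussian_density_def gauss_kernel_def)
    then show "ennreal (?c * (p x * gauss_kernel \<sigma> ?y))
        = ennreal (p x) * ennreal (std_gaussian_density (?y /\<^sub>R \<sigma>) / \<sigma> ^ DIM('a))"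
      using prob_density_nonneg[OF p, of x] by (simp only: ennreal_mult')
  qed
  finally show ?thesis .
qed

lemma borel_measurable_std_gaussian_density [measurable]:
  "std_gaussian_density \<in> borel_measurable borel"
  unfolding std_gaussian_density_def by measurable

text \<open>Both measures are compared on a Borel set \<open>A\<close>. Independence gives the
  product density of \<open>(X, Z)\<close>; for fixed \<open>x\<close> the variable \<open>z\<close>
  is replaced by \<open>u = a x + \<sigma> z\<close>; exchanging the integrals leaves the mixture
  over \<open>x\<close>.\<close>

lemma (in prob_space) distributed_noised_density:
  fixes X Z :: "'a \<Rightarrow> 'b::euclidean_space"
  assumes p: "prob_density p" and \<sigma>: "0 < \<sigma>"
    and X: "distributed M lborel X (\<lambda>x. ennreal (p x))"
    and Z: "distributed M lborel Z (\<lambda>z. ennreal (std_gaussian_density z))"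
    and indep: "indep_var borel X borel Z"
  shows "distributed M lborel (\<lambda>\<omega>. sqrt (1 - \<sigma>\<^sup>2) *\<^sub>R X \<omega> + \<sigma> *\<^sub>R Z \<omega>)
    (\<lambda>u. ennreal (noised_density p \<sigma> u))"
proof -
  define a where "a = sqrt (1 - \<sigma>\<^sup>2)"
  define \<phi> :: "'b \<Rightarrow> real" where "\<phi> = std_gaussian_density"
  have [measurable]: "\<phi> \<in> borel_measurable borel"
    unfolding \<phi>_def by measurable
  note [measurable] = prob_density_measurable[OF p]
  have [measurable]: "random_variable borel X" "random_variable borel Z"
    using indep_var_rv1[OF indep] indep_var_rv2[OF indep] by auto
  have [measurable]: "noised_density p \<sigma> \<in> borel_measurable borel"
    using continuous_on_noised_density[OF p \<sigma>] by (rule borel_measurable_continuous_onI)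
  \<comment> \<open>The joint density rule expects independence with respect to
    \<open>lborel\<close>; composing with \<open>id\<close> transfers it from \<open>borel\<close>,
    which has the same measurable sets.\<close>
  have "indep_var lborel (id \<circ> X) lborel (id \<circ> Z)"
    by (rule indep_var_compose[OF indep]) auto
  then have joint: "distributed M (lborel \<Otimes>\<^sub>M lborel) (\<lambda>\<omega>. (X \<omega>, Z \<omega>))
      (\<lambda>(x, z). ennreal (p x) * ennreal (\<phi> z))"
    unfolding \<phi>_def by (intro distributed_joint_indep X Z lborel.sigma_finite_measure_axioms) simp
  have "distr M lborel (\<lambda>\<omega>. a *\<^sub>R X \<omega> + \<sigma> *\<^sub>R Z \<omega>) = density lborel (\<lambda>u. ennreal (noised_density p \<sigma> u))"
  proof (rule measure_eqI)
    fix A assume "A \<in> sets (distr M lborel (\<lambda>\<omega>. a *\<^sub>R X \<omega> + \<sigma> *\<^sub>R Z \<omega>))"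
    then have [measurable]: "A \<in> sets borel"
      by simp
    let ?I = "indicator A :: 'b \<Rightarrow> ennreal"
    have "emeasure (distr M lborel (\<lambda>\<omega>. a *\<^sub>R X \<omega> + \<sigma> *\<^sub>R Z \<omega>)) A
        = (\<integral>\<^sup>+u. ?I u \<partial>distr M lborel (\<lambda>\<omega>. a *\<^sub>R X \<omega> + \<sigma> *\<^sub>R Z \<omega>))"
      by simp
    also have "\<dots> = (\<integral>\<^sup>+\<omega>. ?I (a *\<^sub>R X \<omega> + \<sigma> *\<^sub>R Z \<omega>) \<partial>M)"
      by (subst nn_integral_distr) auto
    also have "\<dots> = (\<integral>\<^sup>+y. (case y of (x, z) \<Rightarrow> ennreal (p x) * ennreal (\<phi> z)) *
        (case y of (x, z) \<Rightarrow> ?I (a *\<^sub>R x + \<sigma> *\<^sub>R z)) \<partial>(lborel \<Otimes>\<^sub>M lborel))"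
      by (subst distributed_nn_integral[OF joint]) auto
    also have "\<dots> = (\<integral>\<^sup>+x. \<integral>\<^sup>+z. ennreal (p x) * ennreal (\<phi> z) * ?I (a *\<^sub>R x + \<sigma> *\<^sub>R z) \<partial>lborel \<partial>lborel)"
      by (subst lborel.nn_integral_fst[symmetric]) auto
    also have "\<dots> = (\<integral>\<^sup>+x. \<integral>\<^sup>+u. ennreal (p x) * ennreal (\<phi> ((u - a *\<^sub>R x) /\<^sub>R \<sigma>) / \<sigma> ^ DIM('b)) * ?I u \<partial>lborel \<partial>lborel)"
    \<comment> \<open>The Jacobian \<open>\<sigma> ^ DIM('b)\<close> of the substitution cancels the
      division by the same power in the rescaled Gaussian.\<close>
    proof (rule nn_integral_cong)
      fix x
      have "(\<integral>\<^sup>+u. ennreal (p x) * ennreal (\<phi> ((u - a *\<^sub>R x) /\<^sub>R \<sigma>) / \<sigma> ^ DIM('b)) * ?I u \<partial>lborel) =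
          ennreal (\<sigma> ^ DIM('b)) * (\<integral>\<^sup>+z. ennreal (p x) * ennreal (\<phi> z / \<sigma> ^ DIM('b)) * ?I (a *\<^sub>R x + \<sigma> *\<^sub>R z) \<partial>lborel)"
        using \<sigma> by (subst nn_integral_affine_euclidean[where c=\<sigma> and t="a *\<^sub>R x"]) auto
      also have "\<dots> = (\<integral>\<^sup>+z. ennreal (\<sigma> ^ DIM('b)) * (ennreal (p x) * ennreal (\<phi> z / \<sigma> ^ DIM('b)) * ?I (a *\<^sub>R x + \<sigma> *\<^sub>R z)) \<partial>lborel)"
        by (rule nn_integral_cmult[symmetric]) auto
      also have "\<dots> = (\<integral>\<^sup>+z. ennreal (p x) * ennreal (\<phi> z) * ?I (a *\<^sub>R x + \<sigma> *\<^sub>R z) \<partial>lborel)"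
      proof (intro nn_integral_cong)
        fix z
        have "ennreal (\<phi> z) = ennreal (\<sigma> ^ DIM('b)) * ennreal (\<phi> z / \<sigma> ^ DIM('b))"
          using \<sigma> by (subst ennreal_mult[symmetric]) (auto simp: \<phi>_def std_gaussian_density_def)
        then show "ennreal (\<sigma> ^ DIM('b)) * (ennreal (p x) * ennreal (\<phi> z / \<sigma> ^ DIM('b)) * ?I (a *\<^sub>R x + \<sigma> *\<^sub>R z))
            = ennreal (p x) * ennreal (\<phi> z) * ?I (a *\<^sub>R x + \<sigma> *\<^sub>R z)"
          by (simp add: mult_ac)
      qed
      finally show "(\<integral>\<^sup>+z. ennreal (p x) * ennreal (\<phi> z) * ?I (a *\<^sub>R x + \<sigma> *\<^sub>R z) \<partial>lborel) =
          (\<integral>\<^sup>+u. ennreal (p x) * ennreal (\<phi> ((u - a *\<^sub>R x) /\<^sub>R \<sigma>) / \<sigma> ^ DIM('b)) * ?I u \<partial>lborel)"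
        by (rule sym)
    qed
    also have "\<dots> = (\<integral>\<^sup>+u. \<integral>\<^sup>+x. ennreal (p x) * ennreal (\<phi> ((u - a *\<^sub>R x) /\<^sub>R \<sigma>) / \<sigma> ^ DIM('b)) * ?I u \<partial>lborel \<partial>lborel)"
      by (rule lborel_pair.Fubini') measurable
    also have "\<dots> = (\<integral>\<^sup>+u. ennreal (noised_density p \<sigma> u) * ?I u \<partial>lborel)"
      by (intro nn_integral_cong)
        (simp add: noised_density_nn_integral[OF p \<sigma>] a_def \<phi>_def nn_integral_multc)
    also have "\<dots> = emeasure (density lborel (\<lambda>u. ennreal (noised_density p \<sigma> u))) A"
      by (rule emeasure_density[symmetric]) auto
    finally show "emeasure (distr M lborel (\<lambda>\<omega>. a *\<^sub>R X \<omega> + \<sigma> *\<^sub>R Z \<omega>)) A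
        = emeasure (density lborel (\<lambda>u. ennreal (noised_density p \<sigma> u))) A" .
  qed simp
  then show ?thesis
    by (simp add: distributed_def a_def)
qed

text \<open>The set of agreement is closed and has null complement, and such a set is the whole
  space.\<close>

lemma continuous_AE_eq_imp_eq:
  fixes f g :: "'a::euclidean_space \<Rightarrow> real"
  assumes "continuous_on UNIV f" "continuous_on UNIV g" "AE x in lborel. f x = g x"
  shows "f = g"
proof
  fix x
  have "closed {x. f x = g x}"
    by (rule closed_Collect_eq[OF assms(1,2)])
  moreover have "AE x in lebesgue. x \<in> {x. f x = g x}"
    using assms(3) by (intro AE_completion) simp
  ultimately show "f x = g x"
    using mem_closed_if_AE_lebesgue by blast
qed

text \<open>Two densities of one law agree almost everywhere, and both are continuous here. This
  turns pointwise questions about the abstract \<open>q\<close> into questions about an explicit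
  integral.\<close>

lemma (in prob_space) convolved_densities_eq_noised_density:
  fixes X Z :: "'a \<Rightarrow> 'b::euclidean_space"
  assumes p: "prob_density p" and \<sigma>: "0 < \<sigma>" "\<sigma> \<le> 1"
    and X: "distributed M lborel X (\<lambda>x. ennreal (p x))"
    and Z: "distributed M lborel Z (\<lambda>z. ennreal (std_gaussian_density z))"
    and indep: "indep_var borel X borel Z"
    and q: "convolved_densities M X Z p q"
  shows "q w \<sigma> = noised_density p \<sigma> w"
proof -
  have q': "0 \<le> q u \<sigma>" "continuous_on UNIV (\<lambda>u. q u \<sigma>)"
    "distributed M lborel (\<lambda>\<omega>. sqrt (1 - \<sigma>\<^sup>2) *\<^sub>R X \<omega> + \<sigma> *\<^sub>R Z \<omega>) (\<lambda>u. ennreal (q u \<sigma>))" for u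
    using q \<sigma> by (auto simp: convolved_densities_def)
  have "AE u in lborel. ennreal (q u \<sigma>) = ennreal (noised_density p \<sigma> u)"
    by (rule distributed_unique[OF q'(3) distributed_noised_density[OF p \<sigma>(1) X Z indep]])
  then have "AE u in lborel. q u \<sigma> = noised_density p \<sigma> u"
    by eventually_elim (simp add: q'(1) noised_density_pos[OF p \<sigma>(1)] less_imp_le)
  with q'(2) continuous_on_noised_density[OF p \<sigma>(1)]
  have "(\<lambda>u. q u \<sigma>) = noised_density p \<sigma>"
    by (rule continuous_AE_eq_imp_eq)
  then show ?thesis
    by (rule fun_cong)
qed

section \<open>Tilting by the exponential of a quadratic\<close>

lemma expect_tilt_factor_pos:
  assumes "prob_density p" "integrable lborel (\<lambda>x. tilt_factor v s x * p x)"
  shows "0 < expect p (tilt_factor v s)"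
  using prob_density_weighted_integral_pos[OF assms(1), of "tilt_factor v s"] assms(2)
  by (simp add: expect_def tilt_factor_def mult.commute)

lemma prob_density_tilt:
  assumes "prob_density p" "integrable lborel (\<lambda>x. tilt_factor v s x * p x)"
  shows "prob_density (tilt p v s)"
proof -
  note E = expect_tilt_factor_pos[OF assms]
  have "tilt p v s = (\<lambda>x. tilt_factor v s x * p x / expect p (tilt_factor v s))"
    by (simp add: tilt_def fun_eq_iff)
  moreover have "0 \<le> tilt p v s x" for x
    using E prob_density_nonneg[OF assms(1), of x] by (simp add: tilt_def tilt_factor_def)
  moreover have "(\<integral>x. tilt_factor v s x * p x / expect p (tilt_factor v s) \<partial>lborel) = 1"
    using E by (simp add: expect_def)
  ultimately show ?thesis
    using assms(2) by (simp add: prob_density_def)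
qed

text \<open>Hypothesis \<open>ab\<close> matches the coefficients of \<open>(norm x)\<^sup>2\<close>
  in the two exponents, and \<open>w'\<close> matches the terms linear in \<open>x\<close>. What
  remains is free of \<open>x\<close> and forms the prefactor.\<close>

lemma tilt_factor_gauss_kernel:
  assumes "0 < \<sigma>" "0 < \<tau>"
    and ab: "b\<^sup>2 / \<tau>\<^sup>2 = s + a\<^sup>2 / \<sigma>\<^sup>2"
    and w': "(b / \<tau>\<^sup>2) *\<^sub>R w' = v + (a / \<sigma>\<^sup>2) *\<^sub>R w"
  shows "tilt_factor v s x * gauss_kernel \<sigma> (w - a *\<^sub>R x) =
    exp ((norm w')\<^sup>2 / (2 * \<tau>\<^sup>2) - (norm w)\<^sup>2 / (2 * \<sigma>\<^sup>2)) * gauss_kernel \<tau> (w' - b *\<^sub>R x)"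
proof -
  have sq: "(norm (y - c *\<^sub>R x))\<^sup>2 / (2 * \<rho>\<^sup>2)
      = (norm y)\<^sup>2 / (2 * \<rho>\<^sup>2) - (c / \<rho>\<^sup>2) * (y \<bullet> x) + c\<^sup>2 / \<rho>\<^sup>2 * (norm x)\<^sup>2 / 2"
    if "0 < \<rho>" for y c and \<rho> :: real
    using that unfolding power2_norm_eq_inner
    by (simp add: inner_diff_left inner_diff_right inner_commute power2_eq_square field_simps)
  have "(b / \<tau>\<^sup>2) * (w' \<bullet> x) = v \<bullet> x + (a / \<sigma>\<^sup>2) * (w \<bullet> x)"
    using arg_cong[OF w', of "\<lambda>y. y \<bullet> x"] by (simp add: inner_add_left)
  then have "v \<bullet> x - 1 / 2 * s * (norm x)\<^sup>2 - (norm (w - a *\<^sub>R x))\<^sup>2 / (2 * \<sigma>\<^sup>2) =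
      (norm w')\<^sup>2 / (2 * \<tau>\<^sup>2) - (norm w)\<^sup>2 / (2 * \<sigma>\<^sup>2) - (norm (w' - b *\<^sub>R x))\<^sup>2 / (2 * \<tau>\<^sup>2)"
    unfolding sq[OF assms(1)] sq[OF assms(2)] ab by (simp add: algebra_simps add_divide_distrib)
  then show ?thesis
    by (simp add: tilt_factor_def gauss_kernel_def flip: exp_add)
qed

text \<open>Integrates the kernel identity against \<open>p\<close>. The power of
  \<open>\<tau> / \<sigma>\<close> is the quotient of the Gaussian normalisations, and the
  expectation comes from normalising the tilt.\<close>

lemma noised_density_tilt:
  fixes p :: "'a::euclidean_space \<Rightarrow> real"
  assumes "0 < \<sigma>" "0 < \<tau>"
    and "(sqrt (1 - \<tau>\<^sup>2))\<^sup>2 / \<tau>\<^sup>2 = s + (sqrt (1 - \<sigma>\<^sup>2))\<^sup>2 / \<sigma>\<^sup>2"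
    and "(sqrt (1 - \<tau>\<^sup>2) / \<tau>\<^sup>2) *\<^sub>R w' = v + (sqrt (1 - \<sigma>\<^sup>2) / \<sigma>\<^sup>2) *\<^sub>R w"
  shows "noised_density (tilt p v s) \<sigma> w = (\<tau> / \<sigma>) ^ DIM('a) / expect p (tilt_factor v s)
    * exp ((norm w')\<^sup>2 / (2 * \<tau>\<^sup>2) - (norm w)\<^sup>2 / (2 * \<sigma>\<^sup>2)) * noised_density p \<tau> w'"
proof -
  let ?E = "expect p (tilt_factor v s)"
  let ?e = "exp ((norm w')\<^sup>2 / (2 * \<tau>\<^sup>2) - (norm w)\<^sup>2 / (2 * \<sigma>\<^sup>2))"
  have "tilt p v s x * gauss_kernel \<sigma> (w - sqrt (1 - \<sigma>\<^sup>2) *\<^sub>R x)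
      = ?e / ?E * (p x * gauss_kernel \<tau> (w' - sqrt (1 - \<tau>\<^sup>2) *\<^sub>R x))" for x
    using tilt_factor_gauss_kernel[OF assms, of x] by (simp add: tilt_def mult_ac)
  then show ?thesis
    using assms(1,2) by (simp add: noised_density_def power_divide)
qed

text \<open>The logarithm splits the product: \<open>ln K\<close> drops out, each quadratic
  contributes a linear term, and whatever depends on the affine argument picks up a factor
  \<open>k\<close> by the chain rule.\<close>

lemma GDERIV_ln_tilted:
  assumes f: "GDERIV (\<lambda>y. ln (f y)) (c + k *\<^sub>R u) :> D"
    and f0: "\<And>y. 0 < f y" and K: "0 < K"
  shows "GDERIV (\<lambda>w. ln (K * exp ((norm (c + k *\<^sub>R w))\<^sup>2 / (2 * \<tau>\<^sup>2) - (norm w)\<^sup>2 / (2 * \<sigma>\<^sup>2)) * f (c + k *\<^sub>R w))) u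
    :> (k / \<tau>\<^sup>2) *\<^sub>R (c + k *\<^sub>R u) - (1 / \<sigma>\<^sup>2) *\<^sub>R u + k *\<^sub>R D"
proof -
  have sq: "GDERIV (\<lambda>w. (norm w)\<^sup>2 / (2 * r\<^sup>2)) x :> (1 / r\<^sup>2) *\<^sub>R x" for r and x :: 'a
    using GDERIV_mult[OF GDERIV_norm_squared[of x] GDERIV_const[of "1 / (2 * r\<^sup>2)"]] by simp
  have eq: "(\<lambda>w. ln (K * exp ((norm (c + k *\<^sub>R w))\<^sup>2 / (2 * \<tau>\<^sup>2) - (norm w)\<^sup>2 / (2 * \<sigma>\<^sup>2)) * f (c + k *\<^sub>R w)))
      = (\<lambda>w. ln K + (((norm (c + k *\<^sub>R w))\<^sup>2 / (2 * \<tau>\<^sup>2) + ln (f (c + k *\<^sub>R w))) - (norm w)\<^sup>2 / (2 * \<sigma>\<^sup>2)))"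
    using K f0 by (simp add: ln_mult_pos fun_eq_iff)
  show ?thesis
    unfolding eq using GDERIV_add[OF GDERIV_const[of "ln K"]
        GDERIV_diff[OF GDERIV_affine_compose[OF GDERIV_add[OF sq f, of \<tau>]] sq[of \<sigma> u]]]
    by (rule GDERIV_subst) (simp add: algebra_simps)
qed

section \<open>Scores at the noise levels 1 and 0\<close>

lemma noised_density_1:
  fixes p :: "'a::euclidean_space \<Rightarrow> real"
  assumes "prob_density p"
  shows "noised_density p 1 w = (2 * pi) powr (- real DIM('a) / 2) * exp (- (norm w)\<^sup>2 / 2)"
  using assms by (simp add: noised_density_def gauss_kernel_def prob_density_def)

text \<open>At noise level 1 the centre of every Gaussian in the mixture is 0, so the standard
  Gaussian remains whatever \<open>p\<close> is. The tilt therefore has the same score.\<close>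

lemma GDERIV_ln_noised_density_1:
  assumes "prob_density p"
  shows "GDERIV (\<lambda>w. ln (noised_density p 1 w)) u :> - u"
proof -
  have eq: "(\<lambda>w. ln (noised_density p 1 w))
      = (\<lambda>w. ln ((2 * pi) powr (- real DIM('a) / 2)) + (norm w)\<^sup>2 * (- 1 / 2))"
    by (simp add: noised_density_1[OF assms] ln_mult_pos fun_eq_iff)
  show ?thesis
    unfolding eq
    by (rule GDERIV_subst[OF GDERIV_add[OF GDERIV_const GDERIV_mult[OF GDERIV_norm_squared GDERIV_const]]]) simp
qed

text \<open>At noise level 0 nothing is smoothed: the log of the tilt is \<open>ln p\<close> plus an
  explicit quadratic and a constant, and the regularity comes from \<open>p\<close> itself.\<close>

lemma GDERIV_ln_tilt:
  assumes p: "prob_density p" and int: "integrable lborel (\<lambda>x. tilt_factor v s x * p x)"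
    and u: "0 < p u" "p differentiable (at u)"
  shows "0 < tilt p v s u"
    and "GDERIV (\<lambda>w. ln (tilt p v s w)) u :> v - s *\<^sub>R u + gradient (\<lambda>w. ln (p w)) u"
proof -
  note E = expect_tilt_factor_pos[OF p int]
  show tilt_pos: "0 < tilt p v s u"
    using E u by (simp add: tilt_def tilt_factor_def)
  have "(\<lambda>w. ln (p w)) differentiable (at u)"
    using GDERIV_ln[OF GDERIV_gradient[OF u(2)] u(1)] by (rule GDERIV_imp_differentiable)
  then have lnp: "GDERIV (\<lambda>w. ln (p w)) u :> gradient (\<lambda>w. ln (p w)) u"
    by (rule GDERIV_gradient)
  have inner: "GDERIV (\<lambda>w. v \<bullet> w) u :> v"
    unfolding gderiv_def by (auto intro!: derivative_eq_intros simp: inner_commute)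
  have "GDERIV (\<lambda>w. v \<bullet> w - 1 / 2 * s * (norm w)\<^sup>2 - ln (expect p (tilt_factor v s)) + ln (p w)) u
      :> v - s *\<^sub>R u + gradient (\<lambda>w. ln (p w)) u"
    by (rule GDERIV_subst[OF GDERIV_add[OF GDERIV_diff[OF GDERIV_diff[OF inner
            GDERIV_mult[OF GDERIV_const GDERIV_norm_squared]] GDERIV_const] lnp]]) simp
  then have D: "((\<lambda>w. v \<bullet> w - 1 / 2 * s * (norm w)\<^sup>2 - ln (expect p (tilt_factor v s)) + ln (p w))
      has_derivative (\<lambda>h. h \<bullet> (v - s *\<^sub>R u + gradient (\<lambda>w. ln (p w)) u))) (at u)"
    by (simp add: gderiv_def)
  \<comment> \<open>The formula for the log of the tilt is available where \<open>p\<close> is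
    positive. Continuity gives this near \<open>u\<close>, which suffices for the
    derivative.\<close>
  have "isCont p u"
    using u(2) by (rule differentiable_imp_continuous_within)
  then have ev: "\<forall>\<^sub>F w in at u. 0 < p w"
    using u(1) unfolding isCont_def by (rule order_tendstoD(1))
  have eq: "v \<bullet> w - 1 / 2 * s * (norm w)\<^sup>2 - ln (expect p (tilt_factor v s)) + ln (p w) = ln (tilt p v s w)"
    if "0 < p w" for w
    using that E by (simp add: tilt_def tilt_factor_def ln_mult_pos ln_div)
  show "GDERIV (\<lambda>w. ln (tilt p v s w)) u :> v - s *\<^sub>R u + gradient (\<lambda>w. ln (p w)) u"
    unfolding gderiv_def
  proof (rule has_derivative_transform_eventually[OF D])
    show "\<forall>\<^sub>F w in at u. v \<bullet> w - 1 / 2 * s * (norm w)\<^sup>2 - ln (expect p (tilt_factor v s)) + ln (p w) = ln (tilt p v s w)"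
      using ev by (rule eventually_mono) (rule eq)
  qed (use eq u in auto)
qed

text \<open>Since \<open>gradient\<close> is a definite description and \<open>ln\<close> is total,
  the clauses on positivity and differentiability certify that the scores are genuine. The second
  equation has the pole at \<open>\<sigma> = 0\<close> cancelled, so it covers that level too;
  regularity of \<open>p\<close> at \<open>u\<close> is assumed there, as no smoothing provides
  it.\<close>

theorem theorem3:
  fixes M :: "'w measure"
    and X X' Z :: "'w \<Rightarrow> 'a::euclidean_space"
    and p :: "'a \<Rightarrow> real"
    and q qstar :: "'a \<Rightarrow> real \<Rightarrow> real"
    and v u u' :: 'a
    and s \<sigma> \<sigma>' :: real
  assumes "prob_space M"
    and "prob_density p"
    and "0 \<le> s"
    and "integrable lborel (\<lambda>x. tilt_factor v s x * p x)"
    and "distributed M lborel X (\<lambda>x. ennreal (p x))"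
    and "distributed M lborel X' (\<lambda>x. ennreal (tilt p v s x))"
    and "distributed M lborel Z (\<lambda>z. ennreal (std_gaussian_density z))"
    and "prob_space.indep_var M borel X borel Z"
    and "prob_space.indep_var M borel X' borel Z"
    and "convolved_densities M X Z p q"
    and "convolved_densities M X' Z (tilt p v s) qstar"
    and "\<sigma> \<in> {0..1}"
    and "\<sigma> = 0 \<Longrightarrow> 0 < p u \<and> p differentiable (at u)"
    and "u' = (\<sigma>\<^sup>2 / sqrt ((1 - \<sigma>\<^sup>2 + s * \<sigma>\<^sup>2) * (1 + s * \<sigma>\<^sup>2))) *\<^sub>R v
             + sqrt ((1 - \<sigma>\<^sup>2) / ((1 - \<sigma>\<^sup>2 + s * \<sigma>\<^sup>2) * (1 + s * \<sigma>\<^sup>2))) *\<^sub>R u"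
    and "\<sigma>' = sqrt (\<sigma>\<^sup>2 / (1 + s * \<sigma>\<^sup>2))"
  shows "0 < q u' \<sigma>' \<and> (\<lambda>w. ln (q w \<sigma>')) differentiable (at u') \<and>
    0 < qstar u \<sigma> \<and> (\<lambda>w. ln (qstar w \<sigma>)) differentiable (at u) \<and>
    (0 < \<sigma> \<longrightarrow>
      gradient (\<lambda>w. ln (qstar w \<sigma>)) u =
        - (1 / \<sigma>\<^sup>2) *\<^sub>R (u - sqrt ((1 - \<sigma>\<^sup>2) / (1 - \<sigma>'\<^sup>2)) *\<^sub>R u')
        + (\<sigma>'\<^sup>2 * sqrt (1 - \<sigma>\<^sup>2) / (\<sigma>\<^sup>2 * sqrt (1 - \<sigma>'\<^sup>2)))
            *\<^sub>R gradient (\<lambda>w. ln (q w \<sigma>')) u') \<and>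
    (\<sigma> < 1 \<or> 0 < s \<longrightarrow>
      gradient (\<lambda>w. ln (qstar w \<sigma>)) u =
        (1 / (1 - \<sigma>\<^sup>2 + s * \<sigma>\<^sup>2)) *\<^sub>R (sqrt (1 - \<sigma>\<^sup>2) *\<^sub>R v - s *\<^sub>R u)
        + sqrt ((1 - \<sigma>\<^sup>2) / ((1 - \<sigma>\<^sup>2 + s * \<sigma>\<^sup>2) * (1 + s * \<sigma>\<^sup>2)))
            *\<^sub>R gradient (\<lambda>w. ln (q w \<sigma>')) u')"
proof -
  interpret prob_space M by fact
  note p = assms(2) and s = assms(3) and int = assms(4)
  note p' = prob_density_tilt[OF p int]
  \<comment> \<open>These roots make everything rational: \<open>\<sigma>' = \<sigma> / c\<close>,
    \<open>sqrt (1 - \<sigma>'\<^sup>2) = b / c\<close>, and \<open>u'\<close> has coefficients over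
    \<open>b * c\<close>.\<close>
  define a where "a = sqrt (1 - \<sigma>\<^sup>2)"
  define b where "b = sqrt (1 - \<sigma>\<^sup>2 + s * \<sigma>\<^sup>2)"
  define c where "c = sqrt (1 + s * \<sigma>\<^sup>2)"
  have \<sigma>_sq: "\<sigma>\<^sup>2 \<le> 1" and \<sigma>01: "0 \<le> \<sigma>" "\<sigma> \<le> 1"
    using assms(12) by (auto simp: power_le_one)
  have sq: "a\<^sup>2 = 1 - \<sigma>\<^sup>2" "b\<^sup>2 = 1 - \<sigma>\<^sup>2 + s * \<sigma>\<^sup>2" "c\<^sup>2 = 1 + s * \<sigma>\<^sup>2"
    using \<sigma>_sq s by (simp_all add: a_def b_def c_def)
  have c: "0 < c"
    using s by (auto simp: c_def add_pos_nonneg)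
  have \<sigma>'_eq: "\<sigma>' = \<sigma> / c"
    using \<sigma>01 by (simp add: assms(15) c_def real_sqrt_divide)
  have a'_eq: "sqrt (1 - \<sigma>'\<^sup>2) = b / c"
  proof -
    have "1 - \<sigma>'\<^sup>2 = (c\<^sup>2 - \<sigma>\<^sup>2) / c\<^sup>2"
      using c by (simp add: \<sigma>'_eq power_divide diff_divide_distrib)
    also have "c\<^sup>2 - \<sigma>\<^sup>2 = b\<^sup>2"
      by (simp add: sq)
    finally have "1 - \<sigma>'\<^sup>2 = b\<^sup>2 / c\<^sup>2" .
    then show ?thesis
      using c \<sigma>_sq s by (simp add: real_sqrt_divide b_def)
  qed
  have k_eq: "sqrt ((1 - \<sigma>\<^sup>2) / ((1 - \<sigma>\<^sup>2 + s * \<sigma>\<^sup>2) * (1 + s * \<sigma>\<^sup>2))) = a / (b * c)"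
    by (simp add: a_def b_def c_def real_sqrt_divide real_sqrt_mult)
  have u'_eq: "u' = (\<sigma>\<^sup>2 / (b * c)) *\<^sub>R v + (a / (b * c)) *\<^sub>R u"
    unfolding assms(14) k_eq by (simp add: b_def c_def real_sqrt_mult)
  have r_eq: "sqrt ((1 - \<sigma>\<^sup>2) / (1 - \<sigma>'\<^sup>2)) = a / (b / c)"
    by (simp only: real_sqrt_divide a'_eq a_def)
  \<comment> \<open>The root \<open>b\<close> vanishes exactly when \<open>\<sigma> = 1\<close> and
    \<open>s = 0\<close>; elsewhere with positive noise no denominator is zero.\<close>
  consider (zero) "\<sigma> = 0" | (corner) "\<sigma> = 1" "s = 0" | (pos) "0 < \<sigma>" "0 < b"
  proof -
    have "0 < 1 - \<sigma>\<^sup>2 + s * \<sigma>\<^sup>2" if "0 < \<sigma>" "\<not> (\<sigma> = 1 \<and> s = 0)"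
    proof (cases "\<sigma> = 1")
      case False
      then have "\<sigma>\<^sup>2 < 1"
        using \<sigma>01 by (simp add: power_less_one_iff)
      then show ?thesis
        using s by (simp add: add_pos_nonneg)
    qed (use that s in auto)
    then show thesis
      using that \<sigma>01 by (fastforce simp: b_def)
  qed
  then show ?thesis
  proof cases
    case zero
    have q0: "q w 0 = p w" "qstar w 0 = tilt p v s w" for w
      using assms(10,11) by (auto simp: convolved_densities_def)
    have u: "0 < p u" "p differentiable (at u)"
      using assms(13)[OF zero] by auto
    have u': "u' = u" and \<sigma>': "\<sigma>' = 0"
      using zero by (simp_all add: assms(14,15))
    have diff: "(\<lambda>w. ln (p w)) differentiable (at u)"
      using GDERIV_ln[OF GDERIV_gradient[OF u(2)] u(1)] by (rule GDERIV_imp_differentiable)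
    note lnt = GDERIV_ln_tilt[OF p int u]
    show ?thesis
      unfolding zero u' \<sigma>' q0
      using u diff lnt(1) GDERIV_imp_differentiable[OF lnt(2)] gradient_eqI[OF lnt(2)] by simp
  next
    case corner
    \<comment> \<open>Here \<open>u' = 0\<close> by division by zero. The first equation reads
      \<open>- u\<close> on both sides, and the second is excluded by its premise.\<close>
    have \<sigma>': "\<sigma>' = 1" and u': "u' = 0"
      using corner by (simp_all add: assms(14,15))
    have q1: "q w 1 = noised_density p 1 w" "qstar w 1 = noised_density (tilt p v s) 1 w" for w
      using convolved_densities_eq_noised_density[OF p _ _ assms(5,7,8,10)]
        convolved_densities_eq_noised_density[OF p' _ _ assms(6,7,9,11)] by auto
    note D = GDERIV_ln_noised_density_1[OF p'] GDERIV_ln_noised_density_1[OF p]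
    show ?thesis
      unfolding corner(1) \<sigma>' q1
      using D[THEN GDERIV_imp_differentiable] D[THEN gradient_eqI] corner
        noised_density_pos[OF p] noised_density_pos[OF p']
      by simp
  next
    case pos
    note \<sigma> = pos(1) \<sigma>01(2)
    have \<sigma>': "0 < \<sigma>'" "\<sigma>' \<le> 1"
    proof -
      show "0 < \<sigma>'"
        using \<sigma> c by (simp add: \<sigma>'_eq)
      \<comment> \<open>The real \<open>sqrt\<close> is negative on negative arguments, so
        positivity of \<open>b / c\<close> gives the sign of the radicand. The bound
        \<open>\<sigma>' \<le> 1\<close> is what lets \<open>convolved_densities\<close> speak about
        \<open>\<sigma>'\<close>.\<close>
      have "0 \<le> 1 - \<sigma>'\<^sup>2"
        using a'_eq pos(2) c by (metis divide_pos_pos less_imp_le real_sqrt_ge_0_iff)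
      then show "\<sigma>' \<le> 1"
        by (simp add: power_le_one_iff abs_square_le_1)
    qed
    \<comment> \<open>The point \<open>u'\<close> is affine in \<open>u\<close>, with slope
      \<open>k\<close> and offset \<open>d\<close>; \<open>K\<close> gathers the constants of
      \<open>noised_density_tilt\<close>.\<close>
    define k where "k = a / (b * c)"
    define d where "d = (\<sigma>\<^sup>2 / (b * c)) *\<^sub>R v"
    define K where "K = (\<sigma>' / \<sigma>) ^ DIM('a) / expect p (tilt_factor v s)"
    have K: "0 < K"
      using \<sigma> \<sigma>' expect_tilt_factor_pos[OF p int] by (simp add: K_def)
    have u': "u' = d + k *\<^sub>R u"
      by (simp add: u'_eq k_def d_def)
    have q: "q w \<sigma>' = noised_density p \<sigma>' w" for w
      using convolved_densities_eq_noised_density[OF p \<sigma>' assms(5,7,8,10)] .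
    have qstar: "qstar w \<sigma> = K * exp ((norm (d + k *\<^sub>R w))\<^sup>2 / (2 * \<sigma>'\<^sup>2) - (norm w)\<^sup>2 / (2 * \<sigma>\<^sup>2))
        * noised_density p \<sigma>' (d + k *\<^sub>R w)" for w
    proof -
      \<comment> \<open>The two matching conditions for completing the square:
        \<open>\<sigma>'\<close> solves the quadratic one, and the affine map
        \<open>w \<mapsto> d + k w\<close> solves the linear one.\<close>
      have "(sqrt (1 - \<sigma>'\<^sup>2))\<^sup>2 / \<sigma>'\<^sup>2 = s + (sqrt (1 - \<sigma>\<^sup>2))\<^sup>2 / \<sigma>\<^sup>2"
      proof -
        have "(b / c)\<^sup>2 / (\<sigma> / c)\<^sup>2 = (a\<^sup>2 + s * \<sigma>\<^sup>2) / \<sigma>\<^sup>2"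
          using c sq(1,2) by (simp add: power_divide)
        also have "\<dots> = s + a\<^sup>2 / \<sigma>\<^sup>2"
          using \<sigma> by (simp add: add_divide_distrib)
        \<comment> \<open>The root is rewritten first, since expanding \<open>\<sigma>'\<close>
          would destroy the pattern of \<open>a'_eq\<close>.\<close>
        finally show ?thesis
          unfolding a'_eq a_def[symmetric] unfolding \<sigma>'_eq .
      qed
      moreover have "(sqrt (1 - \<sigma>'\<^sup>2) / \<sigma>'\<^sup>2) *\<^sub>R (d + k *\<^sub>R w) = v + (sqrt (1 - \<sigma>\<^sup>2) / \<sigma>\<^sup>2) *\<^sub>R w"
        unfolding a'_eq a_def[symmetric] d_def k_def unfolding \<sigma>'_eq using \<sigma> c pos(2)
        by (simp add: scaleR_add_right power2_eq_square)
      ultimately show ?thesis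
        unfolding K_def convolved_densities_eq_noised_density[OF p' \<sigma> assms(6,7,9,11)]
        by (rule noised_density_tilt[OF \<sigma>(1) \<sigma>'(1)])
    qed
    define D where "D = gradient (\<lambda>w. ln (q w \<sigma>')) u'"
    obtain D' where "GDERIV (noised_density p \<sigma>') u' :> D'"
      using noised_density_has_gradient[OF p \<sigma>'(1)] .
    then have diff: "(\<lambda>w. ln (q w \<sigma>')) differentiable (at u')"
      unfolding q using GDERIV_ln noised_density_pos[OF p \<sigma>'(1)] GDERIV_imp_differentiable by blast
    have "GDERIV (\<lambda>w. ln (noised_density p \<sigma>' w)) (d + k *\<^sub>R u) :> D"
      using GDERIV_gradient[OF diff] by (simp add: D_def q u')
    then have G: "GDERIV (\<lambda>w. ln (qstar w \<sigma>)) u :> (k / \<sigma>'\<^sup>2) *\<^sub>R u' - (1 / \<sigma>\<^sup>2) *\<^sub>R u + k *\<^sub>R D"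
      unfolding qstar u' using noised_density_pos[OF p \<sigma>'(1)] K by (rule GDERIV_ln_tilted)
    have k': "k / \<sigma>'\<^sup>2 = 1 / \<sigma>\<^sup>2 * (a / (b / c))"
      using \<sigma> c pos(2) by (simp add: \<sigma>'_eq k_def power2_eq_square field_simps)
    have "(k / \<sigma>'\<^sup>2) *\<^sub>R u' - (1 / \<sigma>\<^sup>2) *\<^sub>R u = - (1 / \<sigma>\<^sup>2) *\<^sub>R (u - (a / (b / c)) *\<^sub>R u')"
      unfolding k' by (simp add: scaleR_diff_right)
    moreover have "\<sigma>'\<^sup>2 * a / (\<sigma>\<^sup>2 * (b / c)) = k"
      using \<sigma> c pos(2) by (simp add: \<sigma>'_eq k_def power2_eq_square field_simps)
    \<comment> \<open>Cancelling the pole for the second equation: in the coefficient of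
      \<open>u\<close> the difference \<open>a\<^sup>2 - b\<^sup>2\<close> equals
      \<open>- s * \<sigma>\<^sup>2\<close>, which absorbs the factor
      \<open>1 / \<sigma>\<^sup>2\<close>.\<close>
    moreover have "(k / \<sigma>'\<^sup>2) *\<^sub>R u' - (1 / \<sigma>\<^sup>2) *\<^sub>R u = (1 / b\<^sup>2) *\<^sub>R (a *\<^sub>R v - s *\<^sub>R u)"
    proof -
      have "k / \<sigma>'\<^sup>2 * (\<sigma>\<^sup>2 / (b * c)) = a / b\<^sup>2"
        unfolding k' using \<sigma> c by (simp add: power2_eq_square)
      moreover have "k / \<sigma>'\<^sup>2 * (a / (b * c)) - 1 / \<sigma>\<^sup>2 = - s / b\<^sup>2"
      proof -
        have "k / \<sigma>'\<^sup>2 * (a / (b * c)) - 1 / \<sigma>\<^sup>2 = (a\<^sup>2 - b\<^sup>2) / (\<sigma>\<^sup>2 * b\<^sup>2)"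
          unfolding k' using \<sigma> c pos(2) by (simp add: power2_eq_square field_simps)
        also have "\<dots> = - s / b\<^sup>2"
          using \<sigma> pos(2) sq(1,2) by simp
        finally show ?thesis .
      qed
      moreover have "(k / \<sigma>'\<^sup>2) *\<^sub>R u' - (1 / \<sigma>\<^sup>2) *\<^sub>R u
          = (k / \<sigma>'\<^sup>2 * (\<sigma>\<^sup>2 / (b * c))) *\<^sub>R v + (k / \<sigma>'\<^sup>2 * (a / (b * c)) - 1 / \<sigma>\<^sup>2) *\<^sub>R u"
        unfolding u'_eq by (simp add: scaleR_add_right scaleR_diff_left)
      ultimately show ?thesis
        by (simp add: scaleR_diff_right)
    qed
    ultimately have "gradient (\<lambda>w. ln (qstar w \<sigma>)) u
        = - (1 / \<sigma>\<^sup>2) *\<^sub>R (u - (a / (b / c)) *\<^sub>R u') + (\<sigma>'\<^sup>2 * a / (\<sigma>\<^sup>2 * (b / c))) *\<^sub>R D"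
      and "gradient (\<lambda>w. ln (qstar w \<sigma>)) u = (1 / b\<^sup>2) *\<^sub>R (a *\<^sub>R v - s *\<^sub>R u) + (a / (b * c)) *\<^sub>R D"
      using gradient_eqI[OF G] by (simp_all add: k_def)
    moreover have "0 < q u' \<sigma>'" "0 < qstar u \<sigma>"
      using noised_density_pos[OF p \<sigma>'(1)] K by (simp_all add: q qstar)
    ultimately show ?thesis
      using diff GDERIV_imp_differentiable[OF G]
      unfolding r_eq k_eq a'_eq a_def[symmetric]
      unfolding sq(2)[symmetric] D_def[symmetric] by blast
  qed
qed

end
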